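(* Let $G$ and $H$ be simple connected graphs, each with at least two vertices. Then the Cartesian product $G \Box H$ and the strong product $G \boxtimes H$ are not isomorphic.
   Context: All graphs are finite, undirected and simple (no loops or multiple edges). For graphs $G$ and $H$, the following products have vertex set $V(G)\times V(H)$. The Cartesian product $G \Box H$: $(x,y)\sim(x',y')$ if either ($x\sim x'$ in $G$ and $y=y'$) or ($x=x'$ and $y\sim y'$ in $H$). The strong product $G\boxtimes H$: $(x,y)\sim(x',y')$ if either ($x\sim x'$ in $G$ and $y=y'$) or ($x=x'$ and $y\sim y'$ in $H$) or ($x\sim x'$ in $G$ and $y\sim y'$ in $H$). Two graphs are isomorphic if there is a bijection between their vertex sets that preserves adjacency and non-adjacency. *)

theory Defs
  imports "Graph_Theory.Digraph_Component" "Graph_Theory.Digraph_Isomorphism"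
begin

text \<open>
  A finite simple undirected graph is a \<^locale>\<open>pair_graph\<close>: a finite, symmetric, loop-free set of
  arcs given as ordered pairs of vertices. Adjacency of \<open>x\<close> and \<open>x'\<close> in \<open>G\<close> is
  \<open>(x, x') \<in> parcs G\<close>.
\<close>

definition cartesian_product ::
    "'a pair_pre_digraph \<Rightarrow> 'b pair_pre_digraph \<Rightarrow> ('a \<times> 'b) pair_pre_digraph" where
  "cartesian_product G H = \<lparr>
     pverts = pverts G \<times> pverts H,
     parcs = {((x, y), (x', y')) | x y x' y'.
       (x, y) \<in> pverts G \<times> pverts H \<and> (x', y') \<in> pverts G \<times> pverts H \<and>
       (((x, x') \<in> parcs G \<and> y = y') \<or> (x = x' \<and> (y, y') \<in> parcs H))} \<rparr>"

definition strong_product ::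
    "'a pair_pre_digraph \<Rightarrow> 'b pair_pre_digraph \<Rightarrow> ('a \<times> 'b) pair_pre_digraph" where
  "strong_product G H = \<lparr>
     pverts = pverts G \<times> pverts H,
     parcs = {((x, y), (x', y')) | x y x' y'.
       (x, y) \<in> pverts G \<times> pverts H \<and> (x', y') \<in> pverts G \<times> pverts H \<and>
       (((x, x') \<in> parcs G \<and> y = y') \<or> (x = x' \<and> (y, y') \<in> parcs H) \<or>
        ((x, x') \<in> parcs G \<and> (y, y') \<in> parcs H))} \<rparr>"

lemma pair_graph_cartesian_product:
  assumes "pair_graph G" "pair_graph H"
  shows "pair_graph (cartesian_product G H)"
proof -
  interpret G: pair_graph G by fact
  interpret H: pair_graph H by fact
  have fin: "finite (parcs (cartesian_product G H))"
    by (rule finite_subset[of _ "(pverts G \<times> pverts H) \<times> (pverts G \<times> pverts H)"])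
      (auto simp: cartesian_product_def G.pair_finite_verts H.pair_finite_verts)
  have sym: "sym (parcs (cartesian_product G H))"
    using G.pair_sym_arcs H.pair_sym_arcs
    by (auto simp: cartesian_product_def symmetric_def intro!: symI dest: symD)
  show ?thesis
    using fin sym G.pair_no_loops H.pair_no_loops
    by unfold_locales
      (auto simp: symmetric_def cartesian_product_def G.pair_finite_verts H.pair_finite_verts)
qed

lemma pair_graph_strong_product:
  assumes "pair_graph G" "pair_graph H"
  shows "pair_graph (strong_product G H)"
proof -
  interpret G: pair_graph G by fact
  interpret H: pair_graph H by fact
  have fin: "finite (parcs (strong_product G H))"
    by (rule finite_subset[of _ "(pverts G \<times> pverts H) \<times> (pverts G \<times> pverts H)"])
      (auto simp: strong_product_def G.pair_finite_verts H.pair_finite_verts)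
  have sym: "sym (parcs (strong_product G H))"
    using G.pair_sym_arcs H.pair_sym_arcs
    by (auto simp: strong_product_def symmetric_def intro!: symI dest: symD)
  show ?thesis
    using fin sym G.pair_no_loops H.pair_no_loops
    by unfold_locales
      (auto simp: symmetric_def strong_product_def G.pair_finite_verts H.pair_finite_verts)
qed

text \<open>
  The library's \<^const>\<open>digraph_iso\<close> also maps arcs. On graphs without parallel arcs it says exactly
  that some bijection of the vertex sets preserves adjacency and non-adjacency.
\<close>

lemma digraph_iso_pair_iff:
  assumes "pair_wf_digraph G" "pair_wf_digraph H"
  shows "digraph_iso (with_proj G) (with_proj H) \<longleftrightarrow>
    (\<exists>f. bij_betw f (pverts G) (pverts H) \<and>
      (\<forall>u\<in>pverts G. \<forall>v\<in>pverts G. (u, v) \<in> parcs G \<longleftrightarrow> (f u, f v) \<in> parcs H))"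
    (is "?L \<longleftrightarrow> ?R")
proof
  interpret G: pair_wf_digraph G by fact
  assume ?L
  then obtain h where iso: "G.digraph_isomorphism h" and H: "with_proj H = app_iso h (with_proj G)"
    unfolding digraph_iso_def by auto
  let ?f = "iso_verts h"
  from H have V: "pverts H = ?f ` pverts G" and A: "parcs H = iso_arcs h ` parcs G"
    and t: "iso_tail h = fst" and hd: "iso_head h = snd"
    by (simp_all add: with_proj_def app_iso_def)
  from iso t hd have inj: "inj_on ?f (pverts G)"
    and arcs: "\<And>a. a \<in> parcs G \<Longrightarrow> iso_arcs h a = (?f (fst a), ?f (snd a))"
    by (auto simp: G.digraph_isomorphism_def prod_eq_iff)
  have "(u, v) \<in> parcs G \<longleftrightarrow> (?f u, ?f v) \<in> parcs H" if "u \<in> pverts G" "v \<in> pverts G" for u v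
  proof
    assume "(u, v) \<in> parcs G"
    then show "(?f u, ?f v) \<in> parcs H" using A arcs by force
  next
    assume "(?f u, ?f v) \<in> parcs H"
    then obtain a where a: "a \<in> parcs G" "?f u = ?f (fst a)" "?f v = ?f (snd a)"
      using A arcs by auto
    then have "u = fst a" "v = snd a"
      using inj that G.arc_fst_in_verts G.arc_snd_in_verts by (auto dest: inj_onD)
    with a show "(u, v) \<in> parcs G" by simp
  qed
  then show ?R using inj V by (auto simp: bij_betw_def intro!: exI[of _ ?f])
next
  interpret G: pair_wf_digraph G by fact
  interpret H: pair_wf_digraph H by fact
  assume ?R
  then obtain f where bij: "bij_betw f (pverts G) (pverts H)"
    and adj: "\<And>u v. u \<in> pverts G \<Longrightarrow> v \<in> pverts G \<Longrightarrow> (u, v) \<in> parcs G \<longleftrightarrow> (f u, f v) \<in> parcs H"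
    by auto
  let ?h = "\<lparr> iso_verts = f, iso_arcs = map_prod f f, iso_head = snd, iso_tail = fst \<rparr>"
  have inj: "inj_on f (pverts G)" and V: "f ` pverts G = pverts H"
    using bij by (auto simp: bij_betw_def)
  have "inj_on (map_prod f f) (parcs G)"
    by (rule inj_on_subset[OF map_prod_inj_on[OF inj inj]])
      (auto dest: G.in_arcsD1 G.in_arcsD2)
  then have "G.digraph_isomorphism ?h"
    using inj by (simp add: G.digraph_isomorphism_def G.wf_digraph)
  moreover have "map_prod f f ` parcs G = parcs H"
  proof
    show "map_prod f f ` parcs G \<subseteq> parcs H"
      using adj by (auto dest: G.in_arcsD1 G.in_arcsD2)
    show "parcs H \<subseteq> map_prod f f ` parcs G"
    proof
      fix e assume e: "e \<in> parcs H"
      then obtain u v where uv: "u \<in> pverts G" "v \<in> pverts G" "e = (f u, f v)"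
        using V H.arc_fst_in_verts[OF e] H.arc_snd_in_verts[OF e]
        by (metis imageE prod.collapse)
      with e adj have "(u, v) \<in> parcs G" by simp
      with uv show "e \<in> map_prod f f ` parcs G" by force
    qed
  qed
  then have "with_proj H = app_iso ?h (with_proj G)"
    using V by (simp add: with_proj_def app_iso_def)
  ultimately show ?L unfolding digraph_iso_def by blast
qed

end

theory Submission
  imports Defs
begin

text \<open>
  Isomorphic digraphs have equally many arcs. The arcs of the Cartesian product are among those of
  the strong product, and one arc in each factor gives a diagonal arc of the strong product only.
\<close>

text \<open>The isomorphism presents \<open>arcs H\<close> as the image of \<open>arcs G\<close>
  under its arc map, and the image of a finite set is no larger than the set.\<close>

lemma card_arcs_digraph_iso_le:
  assumes "digraph_iso G H" "finite (arcs G)"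
  shows "card (arcs H) \<le> card (arcs G)"
  using assms by (auto simp: digraph_iso_def app_iso_def intro: card_image_le)

lemma connected_arcs_nonempty:
  assumes "connected G" "card (verts G) \<ge> 2"
  shows "arcs G \<noteq> {}"
proof
  assume empty: "arcs G = {}"
  obtain u v where uv: "u \<in> verts G" "v \<in> verts G" "u \<noteq> v"
    using assms(2) by (auto simp: card_le_Suc_iff numeral_2_eq_2)
  \<comment> \<open>\<open>connected\<close> means strong connectivity of the symmetric closure, so
    the path lives in \<open>mk_symmetric G\<close>.\<close>
  have "u \<rightarrow>\<^sup>*\<^bsub>with_proj (mk_symmetric G)\<^esub> v"
    using assms(1) uv by (auto simp: connected_def strongly_connected_def)
  moreover have "parcs (mk_symmetric G) = {}"
    using empty by (simp add: mk_symmetric_def arcs_ends_def)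
  \<comment> \<open>Without arcs, reachability is reduced to its reflexive case, which would force
    \<open>u = v\<close>.\<close>
  ultimately show False
    using uv(3) by (auto simp: reachable_def arcs_ends_def elim: rtrancl_on.cases)
qed

lemma parcs_cartesian_psubset_strong:
  assumes "pair_wf_digraph G" "pair_wf_digraph H"
    and loopfree: "\<And>x. (x, x) \<notin> parcs G" "\<And>y. (y, y) \<notin> parcs H"
    and nonempty: "parcs G \<noteq> {}" "parcs H \<noteq> {}"
  shows "parcs (cartesian_product G H) \<subset> parcs (strong_product G H)"
proof -
  interpret G: pair_wf_digraph G by fact
  interpret H: pair_wf_digraph H by fact
  obtain x x' y y' where xy: "(x, x') \<in> parcs G" "(y, y') \<in> parcs H"
    using nonempty by auto
  then have "((x, y), (x', y')) \<in> parcs (strong_product G H)"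
    by (auto simp: strong_product_def dest: G.in_arcsD1 G.in_arcsD2 H.in_arcsD1 H.in_arcsD2)
  \<comment> \<open>An arc of the Cartesian product fixes one coordinate, while loop-freeness gives
    \<open>x \<noteq> x'\<close> and \<open>y \<noteq> y'\<close>.\<close>
  moreover have "((x, y), (x', y')) \<notin> parcs (cartesian_product G H)"
    using xy loopfree by (auto simp: cartesian_product_def)
  moreover have "parcs (cartesian_product G H) \<subseteq> parcs (strong_product G H)"
    by (auto simp: cartesian_product_def strong_product_def)
  ultimately show ?thesis by blast
qed

theorem theorem3p4:
  fixes G :: "'a pair_pre_digraph" and H :: "'b pair_pre_digraph"
  assumes "pair_graph G" and "pair_graph H"
    and "connected (with_proj G)" and "connected (with_proj H)"
    and "card (pverts G) \<ge> 2" and "card (pverts H) \<ge> 2"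
  shows "\<not> digraph_iso (with_proj (cartesian_product G H)) (with_proj (strong_product G H))"
proof
  interpret G: pair_graph G by fact
  interpret H: pair_graph H by fact
  \<comment> \<open>Both products have finite arc sets: for \<open>C\<close> this bounds the size of
    the image under an isomorphism, for \<open>S\<close> it turns strict inclusion into a strict
    inequality of cardinalities.\<close>
  interpret C: pair_graph "cartesian_product G H"
    by (intro pair_graph_cartesian_product assms)
  interpret S: pair_graph "strong_product G H"
    by (intro pair_graph_strong_product assms)
  assume "digraph_iso (with_proj (cartesian_product G H)) (with_proj (strong_product G H))"
  then have "card (parcs (strong_product G H)) \<le> card (parcs (cartesian_product G H))"
    using card_arcs_digraph_iso_le C.pair_finite_arcs by fastforce
  \<comment> \<open>Connectedness and the vertex counts enter here, to supply the two arcs that span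
    a diagonal.\<close>
  moreover have "parcs G \<noteq> {}" "parcs H \<noteq> {}"
    using connected_arcs_nonempty[of "with_proj G"] connected_arcs_nonempty[of "with_proj H"] assms
    by simp_all
  then have "parcs (cartesian_product G H) \<subset> parcs (strong_product G H)"
    using G.pair_no_loops H.pair_no_loops
    by (intro parcs_cartesian_psubset_strong G.pair_wf_digraph_axioms H.pair_wf_digraph_axioms) fastforce+
  then have "card (parcs (cartesian_product G H)) < card (parcs (strong_product G H))"
    by (rule psubset_card_mono[OF S.pair_finite_arcs])
  ultimately show False by simp
qed

end
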